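(* For every $n\ge4$ and every $2\le q\le p<\infty$ there exist a Banach space $E$ over $\mathbb{K}$ and a scalar-valued $n$-homogeneous polynomial $P\in\mathcal{P}(^{n}E)$ such that $S_{p;q}(P)\neq\emptyset$ and $S_{p;q}(P)$ fails to be a linear subspace of $E$.
   Context: $\mathbb{K}=\mathbb{R}$ or $\mathbb{C}$. $\mathcal{P}(^{n}E)$ is the space of continuous scalar-valued $n$-homogeneous polynomials on $E$. $\ell_p(F)$ is the space of sequences $(y_j)_{j=1}^\infty$ in a Banach space $F$ with $\sum_j\|y_j\|^p<\infty$. $\ell_q^{w}(E)$ is the space of sequences $(x_j)_{j=1}^\infty$ in $E$ with $(\varphi(x_j))_j\in\ell_q$ for all $\varphi\in E'$ (the dual of $E$), normed by $\|(x_j)_j\|_{w,q}=\sup\{(\sum_j|\varphi(x_j)|^q)^{1/q}:\varphi\in E',\|\varphi\|\le1\}$. $\ell_q^{u}(E)$ (unconditionally $q$-summable sequences) is the subspace of those $(x_j)_j\in\ell_q^w(E)$ with $\lim_{k\to\infty}\|(x_j)_{j=k}^\infty\|_{w,q}=0$. For $1\le q\le p<\infty$, a mapping $f\colon E\to F$ between Banach spaces is $(p;q)$-summing at $a\in E$ if $(f(a+x_j)-f(a))_{j=1}^\infty\in\ell_p(F)$ whenever $(x_j)_{j=1}^\infty\in\ell_q^u(E)$. The $(p;q)$-summing set of $f$ is $S_{p;q}(f)=\{a\in E: f\text{ is }(p;q)\text{-summing at }a\}$. *)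

theory Defs
  imports "HOL-Analysis.Analysis" "HOL-Library.Function_Algebras"
begin

text \<open>
  A Banach space over the scalar field \<open>'k\<close> (used for \<open>real\<close> and \<open>complex\<close>) is given by a
  carrier \<open>E\<close>, a linear subspace of some ambient \<open>'k\<close>-vector space, together with a norm \<open>N\<close>
  on \<open>E\<close> making \<open>E\<close> complete; \<open>N\<close> is arbitrary outside \<open>E\<close>.  Carriers are used because
  existential quantification over types is not available.
\<close>

definition carrier_dist :: "'v::ab_group_add set \<Rightarrow> ('v \<Rightarrow> real) \<Rightarrow> 'v \<Rightarrow> 'v \<Rightarrow> real" where
  \<comment> \<open>set to \<open>0\<close> off \<open>E\<close> because the locale \<open>Metric_space\<close> wants some of its axioms globally\<close>
  "carrier_dist E N x y = (if x \<in> E \<and> y \<in> E then N (x - y) else 0)"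

locale normed_space_on = vector_space scale
  for scale :: "'k::real_normed_field \<Rightarrow> 'v::ab_group_add \<Rightarrow> 'v" +
  fixes E :: "'v set" and N :: "'v \<Rightarrow> real"
  assumes carrier_subspace: "subspace E"
    and N_nonneg: "x \<in> E \<Longrightarrow> 0 \<le> N x"
    and N_eq_0_iff: "x \<in> E \<Longrightarrow> N x = 0 \<longleftrightarrow> x = 0"
    and N_scale: "x \<in> E \<Longrightarrow> N (scale c x) = norm c * N x"
    and N_triangle: "x \<in> E \<Longrightarrow> y \<in> E \<Longrightarrow> N (x + y) \<le> N x + N y"
begin

sublocale Metric_space E "carrier_dist E N"
proof
  have diff: "x - y \<in> E" if "x \<in> E" "y \<in> E" for x y
    using carrier_subspace that by (rule subspace_diff)
  have uminus: "N (- x) = N x" if "x \<in> E" for x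
    using N_scale[OF that, of "- 1"] by simp
  show "0 \<le> carrier_dist E N x y" for x y
    by (simp add: carrier_dist_def N_nonneg diff)
  show "carrier_dist E N x y = carrier_dist E N y x" for x y
    using uminus[OF diff[of x y]] by (simp add: carrier_dist_def)
  show "carrier_dist E N x y = 0 \<longleftrightarrow> x = y" if "x \<in> E" "y \<in> E" for x y
    using that by (simp add: carrier_dist_def N_eq_0_iff diff)
  show "carrier_dist E N x z \<le> carrier_dist E N x y + carrier_dist E N y z"
    if "x \<in> E" "y \<in> E" "z \<in> E" for x y z
    using that N_triangle[OF diff[of x y] diff[of y z]] by (simp add: carrier_dist_def)
qed

definition linear_functional :: "('v \<Rightarrow> 'k) \<Rightarrow> bool" where
  "linear_functional \<phi> \<longleftrightarrow>
     (\<forall>x\<in>E. \<forall>y\<in>E. \<phi> (x + y) = \<phi> x + \<phi> y) \<and> (\<forall>c. \<forall>x\<in>E. \<phi> (scale c x) = c * \<phi> x)"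

definition dual :: "('v \<Rightarrow> 'k) set" where
  "dual = {\<phi>. linear_functional \<phi> \<and> continuous_map mtopology euclidean \<phi>}"

definition dual_norm :: "('v \<Rightarrow> 'k) \<Rightarrow> real" where
  "dual_norm \<phi> = (SUP x\<in>{x\<in>E. N x \<le> 1}. norm (\<phi> x))"

text \<open>
  An \<open>n\<close>-tuple of vectors of \<open>E\<close> is an extensional function on \<open>{..<n}\<close>; an \<open>n\<close>-linear form is
  a function on such tuples.
\<close>

definition multilinear_form :: "nat \<Rightarrow> ((nat \<Rightarrow> 'v) \<Rightarrow> 'k) \<Rightarrow> bool" where
  "multilinear_form n A \<longleftrightarrow>
     (\<forall>x \<in> {..<n} \<rightarrow>\<^sub>E E. \<forall>i<n.
        (\<forall>u\<in>E. \<forall>v\<in>E. A (x(i := u + v)) = A (x(i := u)) + A (x(i := v))) \<and>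
        (\<forall>c. \<forall>u\<in>E. A (x(i := scale c u)) = c * A (x(i := u))))"

definition hom_polynomials :: "nat \<Rightarrow> ('v \<Rightarrow> 'k) set" where
  "hom_polynomials n =
     {P. continuous_map mtopology euclidean P \<and>
         (\<exists>A. multilinear_form n A \<and> (\<forall>x\<in>E. P x = A (\<lambda>i\<in>{..<n}. x)))}"

end

text \<open>Strongly \<open>p\<close>-summable sequences; all sequences are indexed from \<open>0\<close>.\<close>

definition ell :: "real \<Rightarrow> (nat \<Rightarrow> 'f::real_normed_vector) set" where
  "ell p = {y. summable (\<lambda>j. norm (y j) powr p)}"

locale banach_space_on = normed_space_on scale E N
  for scale :: "'k::real_normed_field \<Rightarrow> 'v::ab_group_add \<Rightarrow> 'v" and E N +
  assumes complete: "mcomplete"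
begin

definition ell_weak :: "real \<Rightarrow> (nat \<Rightarrow> 'v) set" where
  "ell_weak q = {x. range x \<subseteq> E \<and> (\<forall>\<phi>\<in>dual. (\<lambda>j. \<phi> (x j)) \<in> ell q)}"

text \<open>
  For \<open>x \<in> ell_weak q\<close> and \<open>1 \<le> q\<close> the supremum below is over a nonempty bounded set (closed
  graph theorem, \<open>E\<close> being complete), so taking it in \<open>real\<close> is unproblematic.
\<close>

definition weak_norm :: "real \<Rightarrow> (nat \<Rightarrow> 'v) \<Rightarrow> real" where
  "weak_norm q x =
     (SUP \<phi>\<in>{\<phi>\<in>dual. dual_norm \<phi> \<le> 1}. (\<Sum>j. norm (\<phi> (x j)) powr q) powr (1 / q))"

definition ell_uncond :: "real \<Rightarrow> (nat \<Rightarrow> 'v) set" where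
  "ell_uncond q = {x\<in>ell_weak q. (\<lambda>k. weak_norm q (\<lambda>j. x (k + j))) \<longlonglongrightarrow> 0}"

definition summing_at :: "real \<Rightarrow> real \<Rightarrow> ('v \<Rightarrow> 'f::real_normed_vector) \<Rightarrow> 'v \<Rightarrow> bool" where
  "summing_at p q f a \<longleftrightarrow> (\<forall>x\<in>ell_uncond q. (\<lambda>j. f (a + x j) - f a) \<in> ell p)"

definition summing_set :: "real \<Rightarrow> real \<Rightarrow> ('v \<Rightarrow> 'f::real_normed_vector) \<Rightarrow> 'v set" where
  "summing_set p q f = {a\<in>E. summing_at p q f a}"

end

end

theory Submission
  imports Defs
begin

text \<open>
  The example is the polynomial \<open>P x = (x 0)^(n - 3) * x 1 * Q x\<close> with \<open>Q x = (\<Sum>i. (x i)\<^sup>2)\<close> on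
  the space \<open>l2\<close> of square-summable sequences. Its summing set contains the two hyperplanes
  \<open>x 0 = 0\<close> and \<open>x 1 = 0\<close>, but not the sum of the first two unit vectors. As \<open>n \<ge> 4\<close>, both
  exponents are positive, and the first two unit vectors lie in these hyperplanes. So the summing
  set is nonempty and not closed under addition.

  The factor \<open>Q\<close> destroys summability: for \<open>q \<ge> 2\<close> the unit vectors of \<open>l2\<close> are weakly
  \<open>q\<close>-summable, so their multiples by a decreasing null sequence \<open>l\<close> form an unconditionally
  \<open>q\<close>-summable sequence (\<open>null_multiples_of_unit_vecs_in_ell_uncond\<close>), while \<open>Q\<close> grows along them by
  \<open>(l j)\<^sup>2\<close>, which need not be \<open>p\<close>-summable for any given \<open>p\<close>. Where the factor in front of \<open>Q\<close> is
  nonzero, this shows in \<open>P\<close> (\<open>poly_l2_not_summing_at\<close>). At a point \<open>a\<close> with \<open>a i = 0\<close> for \<open>i = 0\<close>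
  or \<open>i = 1\<close>, on the other hand, \<open>P a = 0\<close>, and \<open>P (a + x)\<close> is at most a constant times
  \<open>norm (x i)\<close> as long as \<open>x\<close> stays bounded. Along a weakly \<open>q\<close>-summable sequence the coordinates
  \<open>x j i\<close> are \<open>q\<close>-summable, hence \<open>p\<close>-summable (\<open>poly_l2_summing_at\<close>). That such a sequence is
  bounded in norm is the uniform boundedness principle, deduced from Baire's theorem.

  All arguments work over any complete normed field \<open>'k\<close> containing the reals, and are instantiated
  to the real and the complex field at the end.
\<close>

section \<open>Summable sequences and continuous functionals\<close>

text \<open>
  The terms of \<open>w\<close> are eventually at most \<open>1\<close> in norm, where a larger exponent gives a smaller power.
\<close>
lemma ell_mono:
  assumes w: "w \<in> ell q" and q: "0 < q" "q \<le> p"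
    and le: "\<And>j. norm (y j) \<le> C * norm (w j)"
  shows "y \<in> ell p"
proof -
  have sw: "summable (\<lambda>j. norm (w j) powr q)"
    using w by (simp add: ell_def)
  have "\<forall>\<^sub>F j in sequentially. norm (w j) powr q < 1"
    using summable_LIMSEQ_zero[OF sw] by (rule order_tendstoD) simp
  then have "\<forall>\<^sub>F j in sequentially. norm (norm (y j) powr p) \<le> \<bar>C\<bar> powr p * norm (w j) powr q"
  proof eventually_elim
    case (elim j)
    have w1: "norm (w j) \<le> 1"
    proof (rule ccontr)
      assume "\<not> norm (w j) \<le> 1"
      then have "1 \<le> norm (w j) powr q"
        using q by (intro ge_one_powr_ge_zero) auto
      then show False using elim by simp
    qed
    have "norm (y j) \<le> \<bar>C\<bar> * norm (w j)"
      using le[of j] by (meson abs_ge_self mult_right_mono norm_ge_zero order_trans)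
    then have "norm (y j) powr p \<le> (\<bar>C\<bar> * norm (w j)) powr p"
      using q by (intro powr_mono2) auto
    also have "\<dots> = \<bar>C\<bar> powr p * norm (w j) powr p"
      by (simp add: powr_mult)
    also have "\<dots> \<le> \<bar>C\<bar> powr p * norm (w j) powr q"
      using w1 q by (intro mult_left_mono powr_mono') auto
    finally show ?case by simp
  qed
  then have "summable (\<lambda>j. norm (y j) powr p)"
    by (rule summable_comparison_test_ev) (rule summable_mult[OF sw])
  then show ?thesis by (simp add: ell_def)
qed

context normed_space_on
begin

text \<open>
  Pointwise limits make the limit rules for sums and products available for carrier-based spaces.
\<close>
lemma continuous_map_iff_tendsto:
  "continuous_map mtopology euclidean f \<longleftrightarrow> (\<forall>a\<in>E. (f \<longlongrightarrow> f a) (atin mtopology a))"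
  by (simp add: continuous_map_atin)

lemma tendsto_N_diff:
  assumes "a \<in> E"
  shows "((\<lambda>x. N (x - a)) \<longlongrightarrow> 0) (atin mtopology a)"
proof (rule tendstoI)
  fix e :: real assume "0 < e"
  have "\<bar>N (x - a)\<bar> < e" if "x \<in> E" "carrier_dist E N x a < e" for x
  proof -
    have "x - a \<in> E" using carrier_subspace that(1) assms by (rule subspace_diff)
    then show ?thesis using that assms N_nonneg[of "x - a"] by (simp add: carrier_dist_def)
  qed
  then show "\<forall>\<^sub>F x in atin mtopology a. dist (N (x - a)) 0 < e"
    using \<open>0 < e\<close> by (auto simp: eventually_atin_metric)
qed

lemma linear_functional_add:
  "linear_functional \<phi> \<Longrightarrow> x \<in> E \<Longrightarrow> y \<in> E \<Longrightarrow> \<phi> (x + y) = \<phi> x + \<phi> y"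
  unfolding linear_functional_def by blast

lemma linear_functional_scale:
  "linear_functional \<phi> \<Longrightarrow> x \<in> E \<Longrightarrow> \<phi> (scale c x) = c * \<phi> x"
  unfolding linear_functional_def by blast

lemma linear_functional_diff:
  assumes "linear_functional \<phi>" "x \<in> E" "y \<in> E"
  shows "\<phi> (x - y) = \<phi> x - \<phi> y"
proof -
  have "x - y \<in> E" using carrier_subspace assms(2,3) by (rule subspace_diff)
  then have "\<phi> (x - y + y) = \<phi> (x - y) + \<phi> y"
    using assms by (intro linear_functional_add)
  then show ?thesis by simp
qed

lemma linear_functional_zero: "linear_functional \<phi> \<Longrightarrow> \<phi> 0 = 0"
  using linear_functional_diff[of \<phi> 0 0] subspace_0[OF carrier_subspace] by simp

lemma bounded_functional_in_dual:
  assumes lin: "linear_functional \<phi>" and bound: "\<And>x. x \<in> E \<Longrightarrow> norm (\<phi> x) \<le> C * N x"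
  shows "\<phi> \<in> dual"
proof -
  have "(\<phi> \<longlongrightarrow> \<phi> a) (atin mtopology a)" if a: "a \<in> E" for a
  proof (rule LIM_zero_cancel)
    have "\<forall>\<^sub>F x in atin mtopology a. norm (\<phi> x - \<phi> a) \<le> C * N (x - a)"
      unfolding eventually_atin_metric
    proof (intro exI[of _ 1] conjI allI impI)
      fix x assume "x \<in> E \<and> 0 < carrier_dist E N x a \<and> carrier_dist E N x a < 1"
      then have x: "x \<in> E" by simp
      show "norm (\<phi> x - \<phi> a) \<le> C * N (x - a)"
        using bound[of "x - a"] linear_functional_diff[OF lin x a]
          subspace_diff[OF carrier_subspace x a]
        by simp
    qed simp
    then show "((\<lambda>x. \<phi> x - \<phi> a) \<longlongrightarrow> 0) (atin mtopology a)"
      by (rule Lim_null_comparison) (intro tendsto_mult_right_zero tendsto_N_diff a)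
  qed
  then show ?thesis
    unfolding dual_def continuous_map_iff_tendsto using lin by blast
qed

text \<open>
  The step from local to global boundedness, with an explicit constant: the constant depends only
  on the ball and on the bound there, so that one ball serves a whole family of functionals.
\<close>
lemma functional_bound_from_ball:
  assumes lin: "linear_functional \<phi>" and y: "y \<in> E" and r: "0 < r"
    and ball: "\<And>z. z \<in> E \<Longrightarrow> N (z - y) < r \<Longrightarrow> norm (\<phi> z) \<le> M"
    and x: "x \<in> E"
  shows "norm (\<phi> x) \<le> 4 * M / r * N x"
proof (cases "x = 0")
  case True
  then show ?thesis using linear_functional_zero[OF lin] N_eq_0_iff[OF x] by simp
next
  case False
  then have Nx: "0 < N x" using N_nonneg[OF x] N_eq_0_iff[OF x] by linarith
  \<comment> \<open>the multiple of \<open>x\<close> of norm \<open>r / 2\<close>, so that \<open>y + h\<close> stays in the open ball\<close>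
  define h where "h = scale (of_real (r / (2 * N x))) x"
  have h: "h \<in> E" unfolding h_def using carrier_subspace x by (rule subspace_scale)
  have yh: "y + h \<in> E" using carrier_subspace y h by (rule subspace_add)
  have Nh: "N h = r / 2" unfolding h_def using N_scale[OF x] Nx r by (simp add: norm_mult norm_divide)
  have N0: "N (y - y) = 0" using N_eq_0_iff subspace_0[OF carrier_subspace] by simp
  have "\<phi> (y + h) = \<phi> y + \<phi> h" using lin y h by (rule linear_functional_add)
  then have "\<phi> h = \<phi> (y + h) - \<phi> y" by simp
  then have "norm (\<phi> h) \<le> norm (\<phi> (y + h)) + norm (\<phi> y)"
    by (simp add: norm_triangle_ineq4)
  also have "\<dots> \<le> M + M"
    using ball[OF yh] ball[OF y] Nh N0 r by (intro add_mono) auto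
  finally have hM: "norm (\<phi> h) \<le> 2 * M" by simp
  have "\<phi> h = of_real (r / (2 * N x)) * \<phi> x"
    unfolding h_def using lin x by (rule linear_functional_scale)
  then have "norm (\<phi> h) = r / (2 * N x) * norm (\<phi> x)"
    using Nx r by (simp add: norm_mult norm_divide)
  then have "norm (\<phi> x) = 2 * norm (\<phi> h) / r * N x" using Nx r by (simp add: field_simps)
  also have "\<dots> \<le> 2 * (2 * M) / r * N x"
    using hM Nx r by (intro mult_right_mono divide_right_mono mult_left_mono) auto
  finally show ?thesis by simp
qed

text \<open>
  The content is that the supremum defining \<open>dual_norm \<phi>\<close> is over a bounded set. Continuity at \<open>0\<close>
  provides the bound; without it the supremum in \<open>real\<close> would be an unspecified number.
\<close>
lemma dual_norm_bound:
  assumes \<phi>: "\<phi> \<in> dual" and x: "x \<in> E"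
  shows "norm (\<phi> x) \<le> dual_norm \<phi> * N x"
proof -
  have lin: "linear_functional \<phi>" using \<phi> by (simp add: dual_def)
  have zero: "0 \<in> E" using subspace_0[OF carrier_subspace] .
  have "(\<phi> \<longlongrightarrow> \<phi> 0) (atin mtopology 0)"
    using \<phi> zero unfolding dual_def continuous_map_iff_tendsto by blast
  then have "\<forall>\<^sub>F x in atin mtopology 0. dist (\<phi> x) 0 < 1"
    using linear_functional_zero[OF lin] by (auto dest: tendstoD[where e=1])
  then obtain r where r: "0 < r"
    and ball: "\<And>x. x \<in> E \<Longrightarrow> 0 < carrier_dist E N x 0 \<Longrightarrow> carrier_dist E N x 0 < r \<Longrightarrow> norm (\<phi> x) < 1"
    using zero by (auto simp: eventually_atin_metric)
  have "norm (\<phi> z) \<le> 1" if z: "z \<in> E" "N (z - 0) < r" for z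
  proof (cases "z = 0")
    case True then show ?thesis using linear_functional_zero[OF lin] by simp
  next
    case False
    then have "0 < N z" using N_nonneg[OF z(1)] N_eq_0_iff[OF z(1)] by linarith
    then show ?thesis using ball[of z] z zero by (simp add: carrier_dist_def)
  qed
  then have C: "norm (\<phi> z) \<le> 4 * 1 / r * N z" if "z \<in> E" for z
    using functional_bound_from_ball[OF lin zero r _ that] by blast
  have bdd: "bdd_above ((\<lambda>x. norm (\<phi> x)) ` {x \<in> E. N x \<le> 1})"
  proof (rule bdd_aboveI2)
    fix z assume "z \<in> {x \<in> E. N x \<le> 1}"
    then show "norm (\<phi> z) \<le> 4 / r"
      using C[of z] mult_left_mono[of "N z" 1 "4 / r"] r by auto
  qed
  show ?thesis
  proof (cases "x = 0")
    case True
    then show ?thesis using linear_functional_zero[OF lin] N_eq_0_iff[OF x] by simp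
  next
    case False
    then have Nx: "0 < N x" using N_nonneg[OF x] N_eq_0_iff[OF x] by linarith
    define h where "h = scale (of_real (1 / N x)) x"
    have h: "h \<in> E" unfolding h_def using carrier_subspace x by (rule subspace_scale)
    have "N h = 1" unfolding h_def using N_scale[OF x] Nx by (simp add: norm_divide)
    then have "norm (\<phi> h) \<le> dual_norm \<phi>"
      unfolding dual_norm_def using h by (intro cSUP_upper bdd) auto
    moreover have "\<phi> h = of_real (1 / N x) * \<phi> x"
      unfolding h_def using lin x by (rule linear_functional_scale)
    then have "norm (\<phi> h) = norm (\<phi> x) / N x"
      using Nx by (simp add: norm_mult norm_divide)
    ultimately show ?thesis using Nx by (simp add: field_simps)
  qed
qed

lemma dual_norm_zero: "dual_norm (\<lambda>_. 0) = 0"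
proof -
  have "0 \<in> {x \<in> E. N x \<le> 1}"
    using subspace_0[OF carrier_subspace] N_eq_0_iff[of 0] by simp
  then show ?thesis unfolding dual_norm_def by (subst cSUP_const) auto
qed

end

text \<open>
  The Banach--Steinhaus theorem for sequences of functionals. The closed sets
  \<open>{y. \<forall>j. norm (\<phi> j y) \<le> M}\<close>, \<open>M \<in> \<nat>\<close>, cover the complete space \<open>E\<close>, so by Baire one of
  them contains a ball.
\<close>
lemma (in banach_space_on) uniform_boundedness:
  assumes \<phi>: "\<And>j. \<phi> j \<in> dual" and pointwise: "\<And>y. y \<in> E \<Longrightarrow> bounded (range (\<lambda>j. \<phi> j y))"
  obtains C where "\<And>j x. x \<in> E \<Longrightarrow> norm (\<phi> j x) \<le> C * N x"
proof -
  define F where "F M = (\<Inter>j. {y \<in> E. \<phi> j y \<in> cball 0 (real M)})" for M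
  have closed: "closedin mtopology (F M)" for M
    unfolding F_def
  proof (rule closedin_Inter; clarsimp)
    fix j
    have "continuous_map mtopology euclidean (\<phi> j)" using \<phi> by (simp add: dual_def)
    from closedin_continuous_map_preimage[OF this, of "cball 0 (real M)"]
    show "closedin mtopology {y \<in> E. norm (\<phi> j y) \<le> real M}" by simp
  qed
  have cover: "(\<Union>M. F M) = E"
  proof (intro equalityI subsetI)
    fix y assume y: "y \<in> E"
    obtain b where "\<And>j. norm (\<phi> j y) \<le> b"
      using pointwise[OF y] unfolding bounded_iff by blast
    moreover obtain M where "b \<le> real M" using real_arch_simple by blast
    ultimately have "y \<in> F M" using y unfolding F_def by (auto intro: order_trans)
    then show "y \<in> (\<Union>M. F M)" by blast
  qed (auto simp: F_def)
  have "0 \<in> E" using subspace_0[OF carrier_subspace] .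
  then have "mtopology interior_of (\<Union>(range F)) \<noteq> {}"
    using cover interior_of_topspace[of mtopology] by auto
  then obtain M where "mtopology interior_of (F M) \<noteq> {}"
    using metric_Baire_category_alt[OF complete, of "range F"] closed by auto
  then obtain y T where "openin mtopology T" "y \<in> T" "T \<subseteq> F M"
    unfolding interior_of_def by auto
  then obtain r where y: "y \<in> E" and r: "0 < r" and ball: "mball y r \<subseteq> F M"
    unfolding openin_mtopology by blast
  have *: "norm (\<phi> j z) \<le> real M" if "z \<in> E" "N (z - y) < r" for j z
  proof -
    have "carrier_dist E N y z < r"
      using that y commute[of y z] by (simp add: carrier_dist_def)
    then show ?thesis using ball that y unfolding F_def by (auto simp: subset_iff)
  qed
  show thesis
  proof (rule that)
    fix j x assume x: "x \<in> E"
    have "linear_functional (\<phi> j)" using \<phi> by (simp add: dual_def)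
    from functional_bound_from_ball[OF this y r * x]
    show "norm (\<phi> j x) \<le> 4 * real M / r * N x" .
  qed
qed

section \<open>The sequence space \<open>l2\<close>\<close>

definition scaled :: "'k \<Rightarrow> (nat \<Rightarrow> 'k) \<Rightarrow> nat \<Rightarrow> 'k::real_normed_field" where
  "scaled c x = (\<lambda>i. c * x i)"

definition l2 :: "(nat \<Rightarrow> 'k::real_normed_field) set" where
  "l2 = {x. summable (\<lambda>i. (norm (x i))\<^sup>2)}"

definition l2norm :: "(nat \<Rightarrow> 'k::real_normed_field) \<Rightarrow> real" where
  "l2norm x = sqrt (\<Sum>i. (norm (x i))\<^sup>2)"

text \<open>
  The truncated norms are finite sums without side conditions; \<open>l2I\<close> turns a uniform
  bound on them into membership in \<open>l2\<close> together with a bound on the norm.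
\<close>
definition trunc_norm :: "(nat \<Rightarrow> 'k::real_normed_field) \<Rightarrow> nat \<Rightarrow> real" where
  "trunc_norm x n = L2_set (\<lambda>i. norm (x i)) {..<n}"

lemma trunc_norm_tendsto: "x \<in> l2 \<Longrightarrow> trunc_norm x \<longlonglongrightarrow> l2norm x"
  unfolding trunc_norm_def L2_set_def l2norm_def l2_def
  by (auto intro!: tendsto_real_sqrt summable_LIMSEQ)

lemma trunc_norm_le_l2norm: "x \<in> l2 \<Longrightarrow> trunc_norm x n \<le> l2norm x"
  unfolding trunc_norm_def L2_set_def l2norm_def l2_def
  by (auto intro!: real_sqrt_le_mono sum_le_suminf)

lemma l2I:
  assumes "\<And>n. trunc_norm x n \<le> C"
  shows "x \<in> l2" "l2norm x \<le> C"
proof -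
  have "0 \<le> C" using assms[of 0] by (simp add: trunc_norm_def)
  have le: "(\<Sum>i<n. (norm (x i))\<^sup>2) \<le> C\<^sup>2" for n
    using assms[of n] \<open>0 \<le> C\<close> by (simp add: trunc_norm_def L2_set_def sqrt_le_D real_le_lsqrt)
  then have s: "summable (\<lambda>i. (norm (x i))\<^sup>2)"
    by (intro summableI_nonneg_bounded) auto
  then show "x \<in> l2" by (simp add: l2_def)
  show "l2norm x \<le> C"
    unfolding l2norm_def using suminf_le_const[OF s le] \<open>0 \<le> C\<close> by (simp add: real_le_lsqrt)
qed

lemma l2norm_nonneg: "x \<in> l2 \<Longrightarrow> 0 \<le> l2norm x"
  using trunc_norm_le_l2norm[of x 0] by (simp add: trunc_norm_def)

lemma norm_le_l2norm: "x \<in> l2 \<Longrightarrow> norm (x i) \<le> l2norm x"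
  using trunc_norm_le_l2norm[of x "Suc i"] member_le_L2_set[of "{..<Suc i}" i "\<lambda>i. norm (x i)"]
  by (simp add: trunc_norm_def)

lemma trunc_norm_add: "trunc_norm (x + y) n \<le> trunc_norm x n + trunc_norm y n"
proof -
  have "trunc_norm (x + y) n \<le> L2_set (\<lambda>i. norm (x i) + norm (y i)) {..<n}"
    unfolding trunc_norm_def by (rule L2_set_mono) (auto intro: norm_triangle_ineq)
  also have "\<dots> \<le> trunc_norm x n + trunc_norm y n" unfolding trunc_norm_def by (rule L2_set_triangle_ineq)
  finally show ?thesis .
qed

lemma trunc_norm_scaled: "trunc_norm (scaled c x) n = norm c * trunc_norm x n"
  by (simp add: trunc_norm_def scaled_def norm_mult L2_set_right_distrib)

lemma l2_add:
  assumes "x \<in> l2" "y \<in> l2"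
  shows "x + y \<in> l2" "l2norm (x + y) \<le> l2norm x + l2norm y"
proof -
  have "trunc_norm (x + y) n \<le> l2norm x + l2norm y" for n
    using order_trans[OF trunc_norm_add add_mono[OF trunc_norm_le_l2norm trunc_norm_le_l2norm]] assms by blast
  then show "x + y \<in> l2" "l2norm (x + y) \<le> l2norm x + l2norm y" by (rule l2I)+
qed

lemma l2_scaled:
  assumes "x \<in> l2"
  shows "scaled c x \<in> l2" "l2norm (scaled c x) = norm c * l2norm x"
proof -
  have "trunc_norm (scaled c x) n \<le> norm c * l2norm x" for n
    unfolding trunc_norm_scaled by (intro mult_left_mono trunc_norm_le_l2norm assms) simp
  then show *: "scaled c x \<in> l2" by (rule l2I)
  have "trunc_norm (scaled c x) \<longlonglongrightarrow> norm c * l2norm x"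
    unfolding trunc_norm_scaled by (intro tendsto_mult_left trunc_norm_tendsto assms)
  then show "l2norm (scaled c x) = norm c * l2norm x"
    using trunc_norm_tendsto[OF *] LIMSEQ_unique by blast
qed

lemma l2_zero: "0 \<in> l2" "l2norm 0 = 0"
  by (simp_all add: l2_def l2norm_def)

lemma l2_normed_space: "normed_space_on scaled (l2 :: (nat \<Rightarrow> 'k::real_normed_field) set) l2norm"
proof -
  interpret vector_space "scaled :: 'k \<Rightarrow> _"
    by standard (auto simp: scaled_def fun_eq_iff algebra_simps)
  show ?thesis
  proof
    show "subspace (l2 :: (nat \<Rightarrow> 'k) set)"
      unfolding subspace_def by (auto simp: l2_zero l2_add l2_scaled)
  next
    fix x :: "nat \<Rightarrow> 'k" assume x: "x \<in> l2"
    show "0 \<le> l2norm x" using x by (rule l2norm_nonneg)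
    show "l2norm x = 0 \<longleftrightarrow> x = 0"
    proof
      assume "l2norm x = 0"
      then show "x = 0" using norm_le_l2norm[OF x] by (simp add: fun_eq_iff)
    qed (simp add: l2_zero)
    show "l2norm (scaled c x) = norm c * l2norm x" for c
      using x by (rule l2_scaled)
    show "l2norm (x + y) \<le> l2norm x + l2norm y" if "y \<in> l2" for y
      using x that by (rule l2_add)
  qed
qed

text \<open>
  A Cauchy sequence converges in every coordinate. Letting \<open>m'\<close> tend to infinity in the bound on
  the truncated norms of \<open>\<sigma> m - \<sigma> m'\<close> shows that the coordinatewise limit is the norm limit.
\<close>
lemma l2_banach_space:
  "banach_space_on scaled (l2 :: (nat \<Rightarrow> 'k::{real_normed_field,banach}) set) l2norm"
proof -
  interpret normed_space_on scaled "l2 :: (nat \<Rightarrow> 'k) set" l2norm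
    by (rule l2_normed_space)
  have diff: "x - y \<in> l2" if "x \<in> l2" "y \<in> l2" for x y :: "nat \<Rightarrow> 'k"
    using carrier_subspace that by (rule subspace_diff)
  show ?thesis
  proof
    show mcomplete
      unfolding mcomplete_def
    proof (intro allI impI)
      fix \<sigma> :: "nat \<Rightarrow> nat \<Rightarrow> 'k" assume cauchy: "MCauchy \<sigma>"
      then have \<sigma>: "\<sigma> m \<in> l2" for m unfolding MCauchy_def by blast
      have small: "\<exists>M. \<forall>m\<ge>M. \<forall>m'\<ge>M. l2norm (\<sigma> m - \<sigma> m') < e" if "0 < e" for e
        using cauchy that by (simp add: MCauchy_def carrier_dist_def \<sigma>)
      have "Cauchy (\<lambda>m. \<sigma> m i)" for i
      proof (rule metric_CauchyI)
        fix e :: real assume "0 < e"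
        from small[OF this] obtain M
          where M: "\<And>m m'. m \<ge> M \<Longrightarrow> m' \<ge> M \<Longrightarrow> l2norm (\<sigma> m - \<sigma> m') < e" by blast
        have "dist (\<sigma> m i) (\<sigma> m' i) < e" if "m \<ge> M" "m' \<ge> M" for m m'
          using norm_le_l2norm[OF diff[OF \<sigma> \<sigma>], of m m' i] M[OF that] by (simp add: dist_norm)
        then show "\<exists>M. \<forall>m\<ge>M. \<forall>n\<ge>M. dist (\<sigma> m i) (\<sigma> n i) < e" by blast
      qed
      then have "convergent (\<lambda>m. \<sigma> m i)" for i by (simp add: Cauchy_convergent)
      then obtain y where y: "(\<lambda>m. \<sigma> m i) \<longlonglongrightarrow> y i" for i
        unfolding convergent_def by metis
      have lim: "\<exists>M. \<forall>m\<ge>M. \<sigma> m - y \<in> l2 \<and> l2norm (\<sigma> m - y) \<le> e" if e: "0 < e" for e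
      proof -
        from small[OF that] obtain M
          where M: "\<And>m m'. m \<ge> M \<Longrightarrow> m' \<ge> M \<Longrightarrow> l2norm (\<sigma> m - \<sigma> m') < e" by blast
        have "trunc_norm (\<sigma> m - y) n \<le> e" if m: "m \<ge> M" for m n
        proof (rule LIMSEQ_le_const2)
          show "(\<lambda>m'. trunc_norm (\<sigma> m - \<sigma> m') n) \<longlonglongrightarrow> trunc_norm (\<sigma> m - y) n"
            unfolding trunc_norm_def L2_set_def by (auto intro!: tendsto_intros y)
          have "trunc_norm (\<sigma> m - \<sigma> m') n \<le> e" if "m' \<ge> M" for m'
            using trunc_norm_le_l2norm[OF diff[OF \<sigma> \<sigma>], of m m' n] M[OF m that] by simp
          then show "\<exists>M. \<forall>m'\<ge>M. trunc_norm (\<sigma> m - \<sigma> m') n \<le> e" by blast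
        qed
        then have "\<sigma> m - y \<in> l2 \<and> l2norm (\<sigma> m - y) \<le> e" if "m \<ge> M" for m
          using that by (intro conjI l2I) blast+
        then show ?thesis by blast
      qed
      \<comment> \<open>\<open>y\<close> is the difference of \<open>\<sigma> m\<close> and \<open>\<sigma> m - y\<close>, both square-summable\<close>
      have y2: "y \<in> l2"
      proof -
        obtain m where "\<sigma> m - y \<in> l2" using lim[of 1] by auto
        from diff[OF \<sigma> this, of m] show ?thesis by simp
      qed
      have "\<exists>M. \<forall>m\<ge>M. \<sigma> m \<in> l2 \<and> carrier_dist l2 l2norm (\<sigma> m) y < e" if e: "0 < e" for e
      proof -
        obtain M where "\<And>m. m \<ge> M \<Longrightarrow> l2norm (\<sigma> m - y) \<le> e / 2"
          using lim[OF half_gt_zero[OF e]] by blast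
        then have "\<sigma> m \<in> l2 \<and> carrier_dist l2 l2norm (\<sigma> m) y < e" if "m \<ge> M" for m
          using that \<sigma> y2 e unfolding carrier_dist_def by fastforce
        then show ?thesis by blast
      qed
      then have conv: "limitin mtopology \<sigma> y sequentially"
        using y2 by (simp add: limitin_metric eventually_sequentially)
      show "\<exists>y. limitin mtopology \<sigma> y sequentially"
        by (rule exI[of _ y], rule conv)
    qed
  qed
qed

interpretation l2: banach_space_on scaled "l2 :: (nat \<Rightarrow> 'k::{real_normed_field,banach}) set" l2norm
  by (rule l2_banach_space)

section \<open>Functionals on \<open>l2\<close>\<close>

text \<open>
  Bilinear, also over the complex field: \<open>dot x\<close> is then linear, and \<open>\<lambda>x. dot x x\<close> is a
  2-homogeneous polynomial, which the Hermitian inner product would not give.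
\<close>
definition dot :: "(nat \<Rightarrow> 'k) \<Rightarrow> (nat \<Rightarrow> 'k) \<Rightarrow> 'k::real_normed_field" where
  "dot x y = (\<Sum>i. x i * y i)"

definition unit_vec :: "nat \<Rightarrow> nat \<Rightarrow> 'k::real_normed_field" where
  "unit_vec k = (\<lambda>i. if i = k then 1 else 0)"

lemma unit_vec_l2: "unit_vec k \<in> l2"
  unfolding l2_def unit_vec_def mem_Collect_eq by (rule summable_finite[of "{k}"]) auto

lemma l2norm_unit_vec: "l2norm (unit_vec k) = 1"
  unfolding l2norm_def unit_vec_def by (subst suminf_finite[of "{k}"]) auto

lemma dot_unit_vec: "dot (unit_vec k) x = x k"
  unfolding dot_def unit_vec_def by (subst suminf_finite[of "{k}"]) auto

lemma dot_commute: "dot x y = dot y x"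
  by (simp add: dot_def mult.commute)

context
  fixes x y :: "nat \<Rightarrow> 'k::{real_normed_field,banach}"
  assumes xy: "x \<in> l2" "y \<in> l2"
begin

lemma cauchy_schwarz_partial: "(\<Sum>i<n. norm (x i * y i)) \<le> l2norm x * l2norm y"
proof -
  have "(\<Sum>i<n. norm (x i * y i)) \<le> trunc_norm x n * trunc_norm y n"
    using L2_set_mult_ineq[of "\<lambda>i. norm (x i)" "\<lambda>i. norm (y i)" "{..<n}"]
    by (simp add: norm_mult trunc_norm_def)
  also have "\<dots> \<le> l2norm x * l2norm y"
    using xy by (intro mult_mono trunc_norm_le_l2norm l2norm_nonneg) (auto simp: trunc_norm_def)
  finally show ?thesis .
qed

lemma dot_summable_norm: "summable (\<lambda>i. norm (x i * y i))"
  by (rule summableI_nonneg_bounded[OF _ cauchy_schwarz_partial]) simp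

lemma dot_sums: "(\<lambda>i. x i * y i) sums dot x y"
  unfolding dot_def by (rule summable_sums[OF summable_norm_cancel[OF dot_summable_norm]])

lemma norm_dot_le: "norm (dot x y) \<le> l2norm x * l2norm y"
proof -
  have "norm (dot x y) \<le> (\<Sum>i. norm (x i * y i))"
    unfolding dot_def by (rule summable_norm[OF dot_summable_norm])
  also have "\<dots> \<le> l2norm x * l2norm y"
    by (rule suminf_le_const[OF dot_summable_norm cauchy_schwarz_partial])
  finally show ?thesis .
qed

end

lemma dot_add:
  fixes x y z :: "nat \<Rightarrow> 'k::{real_normed_field,banach}"
  assumes "x \<in> l2" "y \<in> l2" "z \<in> l2"
  shows "dot x (y + z) = dot x y + dot x z"
proof -
  have "(\<lambda>i. x i * y i + x i * z i) sums (dot x y + dot x z)"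
    using assms by (intro sums_add dot_sums)
  moreover have "(\<lambda>i. x i * y i + x i * z i) = (\<lambda>i. x i * (y + z) i)"
    by (simp add: distrib_left)
  ultimately have "(\<lambda>i. x i * (y + z) i) sums (dot x y + dot x z)" by (simp only:)
  then show ?thesis unfolding dot_def[of x "y + z"] by (rule sums_unique[symmetric])
qed

lemma dot_scaled:
  fixes x y :: "nat \<Rightarrow> 'k::{real_normed_field,banach}"
  assumes "x \<in> l2" "y \<in> l2"
  shows "dot x (scaled c y) = c * dot x y"
proof -
  have "(\<lambda>i. c * (x i * y i)) sums (c * dot x y)"
    using assms by (intro sums_mult dot_sums)
  moreover have "(\<lambda>i. c * (x i * y i)) = (\<lambda>i. x i * scaled c y i)"
    by (simp add: scaled_def mult.left_commute)
  ultimately have "(\<lambda>i. x i * scaled c y i) sums (c * dot x y)" by (simp only:)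
  then show ?thesis unfolding dot_def[of x "scaled c y"] by (rule sums_unique[symmetric])
qed

lemma dot_in_dual:
  fixes x :: "nat \<Rightarrow> 'k::{real_normed_field,banach}"
  assumes "x \<in> l2"
  shows "dot x \<in> l2.dual"
proof (rule l2.bounded_functional_in_dual)
  show "l2.linear_functional (dot x)"
    unfolding l2.linear_functional_def by (intro conjI ballI allI dot_add dot_scaled assms)
  show "norm (dot x y) \<le> l2norm x * l2norm y" if "y \<in> l2" for y
    using assms that by (rule norm_dot_le)
qed

text \<open>
  The complex conjugate (the identity on the reals), written in terms of the norm so that the real
  and the complex case can be treated at once. At \<open>z = 0\<close> the quotient is \<open>0\<close>.
\<close>
definition conjugate :: "'k \<Rightarrow> 'k::real_normed_field" where
  "conjugate z = of_real ((norm z)\<^sup>2) / z"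

lemma norm_conjugate [simp]: "norm (conjugate z) = norm z"
  by (cases "z = 0") (simp_all add: conjugate_def norm_divide norm_mult power2_eq_square)

lemma conjugate_mult_self: "conjugate z * z = of_real ((norm z)\<^sup>2)"
  by (simp add: conjugate_def)


text \<open>
  The boundedness half of the Riesz representation theorem: evaluating \<open>\<phi>\<close> at the truncated vector
  of its own conjugated coefficients gives \<open>S\<^sup>2 \<le> C * S\<close> for the truncated norm \<open>S\<close>
  of the coefficients. In particular the unit vectors are weakly 2-summable.
\<close>
lemma l2_functional_coefficients:
  fixes \<phi> :: "(nat \<Rightarrow> 'k::{real_normed_field,banach}) \<Rightarrow> 'k"
  assumes lin: "l2.linear_functional \<phi>"
    and bound: "\<And>x. x \<in> l2 \<Longrightarrow> norm (\<phi> x) \<le> C * l2norm x"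
  shows "(\<lambda>i. \<phi> (unit_vec i)) \<in> l2" "l2norm (\<lambda>i. \<phi> (unit_vec i)) \<le> C"
proof -
  define c where "c = (\<lambda>i. \<phi> (unit_vec i))"
  have "trunc_norm c n \<le> C" for n
  proof -
    define z where "z m = (\<lambda>i. if i < m then conjugate (c i) else 0)" for m
    have z: "z m \<in> l2" for m
      unfolding l2_def z_def mem_Collect_eq by (rule summable_finite[of "{..<m}"]) auto
    have Nz: "l2norm (z m) = trunc_norm c m" for m
      unfolding l2norm_def z_def trunc_norm_def L2_set_def
      by (subst suminf_finite[of "{..<m}"]) auto
    have "\<phi> (z m) = of_real ((trunc_norm c m)\<^sup>2)" for m
    proof (induction m)
      case 0
      have "z 0 = 0" by (simp add: z_def fun_eq_iff)
      then have "\<phi> (z 0) = 0" using l2.linear_functional_zero[OF lin] by metis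
      then show ?case by (simp add: trunc_norm_def)
    next
      case (Suc m)
      have "z (Suc m) = z m + scaled (conjugate (c m)) (unit_vec m)"
        by (auto simp: z_def scaled_def unit_vec_def fun_eq_iff less_Suc_eq)
      then have "\<phi> (z (Suc m)) = \<phi> (z m) + \<phi> (scaled (conjugate (c m)) (unit_vec m))"
        using l2.linear_functional_add[OF lin z l2_scaled(1)[OF unit_vec_l2]] by (simp only:)
      also have "\<phi> (scaled (conjugate (c m)) (unit_vec m)) = conjugate (c m) * c m"
        unfolding c_def by (rule l2.linear_functional_scale[OF lin unit_vec_l2])
      finally have "\<phi> (z (Suc m)) = \<phi> (z m) + conjugate (c m) * c m" .
      then show ?case
        using Suc.IH by (simp add: conjugate_mult_self trunc_norm_def L2_set_def sum_nonneg add.commute)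
    qed
    then have "(trunc_norm c n)\<^sup>2 \<le> C * trunc_norm c n"
      using bound[OF z, of n] Nz[of n] by (simp flip: of_real_power)
    moreover have "0 \<le> trunc_norm c n" by (simp add: trunc_norm_def)
    moreover have "0 \<le> C"
      using order_trans[OF norm_ge_zero bound[OF unit_vec_l2, of 0]]
      by (simp add: l2norm_unit_vec)
    ultimately show "trunc_norm c n \<le> C"
      by (cases "trunc_norm c n = 0") (auto simp: power2_eq_square)
  qed
  then show "(\<lambda>i. \<phi> (unit_vec i)) \<in> l2" "l2norm (\<lambda>i. \<phi> (unit_vec i)) \<le> C"
    unfolding c_def by (rule l2I)+
qed


text \<open>
  Weakly \<open>q\<close>-summable sequences are weakly bounded, hence bounded by the uniform boundedness
  principle applied to the functionals \<open>dot (x j)\<close>, whose norms are those of the \<open>x j\<close>.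
\<close>
lemma ell_uncond_bounded:
  fixes x :: "nat \<Rightarrow> nat \<Rightarrow> 'k::{real_normed_field,banach}"
  assumes x: "x \<in> l2.ell_uncond q" and q: "0 < q"
  obtains R where "\<And>j. l2norm (x j) \<le> R"
proof -
  have weak: "x \<in> l2.ell_weak q" using x by (simp add: l2.ell_uncond_def)
  then have x2: "x j \<in> l2" for j unfolding l2.ell_weak_def by auto
  have pointwise: "bounded (range (\<lambda>j. dot (x j) y))" if y: "y \<in> l2" for y
  proof -
    have "(\<lambda>j. dot y (x j)) \<in> ell q"
      using weak dot_in_dual[OF y] unfolding l2.ell_weak_def by blast
    then have "(\<lambda>j. norm (dot y (x j)) powr q) \<longlonglongrightarrow> 0"
      unfolding ell_def by (auto intro: summable_LIMSEQ_zero)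
    then have "bounded (range (\<lambda>j. norm (dot y (x j)) powr q))"
      by (intro convergent_imp_bounded) (auto simp: convergent_def)
    then obtain B where "\<And>j. norm (dot y (x j)) powr q \<le> B"
      unfolding bounded_iff by auto
    then have "(norm (dot y (x j)) powr q) powr (1 / q) \<le> B powr (1 / q)" for j
      using q by (intro powr_mono2) auto
    then have "norm (dot y (x j)) \<le> B powr (1 / q)" for j
      using q by (simp add: powr_powr)
    then show ?thesis unfolding bounded_iff by (auto simp: dot_commute[of _ y])
  qed
  obtain C where C: "\<And>j y. y \<in> l2 \<Longrightarrow> norm (dot (x j) y) \<le> C * l2norm y"
    using l2.uniform_boundedness[of "\<lambda>j. dot (x j)"] dot_in_dual[OF x2] pointwise by blast
  have "l2norm (x j) \<le> C" for j
  proof -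
    have "(\<lambda>i. dot (x j) (unit_vec i)) = x j"
      by (simp add: dot_commute[of "x j"] dot_unit_vec)
    moreover have "l2.linear_functional (dot (x j))"
      using dot_in_dual[OF x2] by (simp add: l2.dual_def)
    ultimately show ?thesis using l2_functional_coefficients(2)[of "dot (x j)" C] C by simp
  qed
  then show thesis by (rule that)
qed

text \<open>
  For \<open>q \<ge> 2\<close> the unit vectors have weak \<open>q\<close>-norm at most \<open>1\<close>, because the coefficient
  sequence of a functional in the dual unit ball lies in the unit ball of \<open>l2\<close>. Multiplication
  with a decreasing null sequence \<open>l\<close>, however slow, brings the weak norm of the \<open>k\<close>-th tail
  below \<open>l k\<close>.
\<close>
lemma null_multiples_of_unit_vecs_in_ell_uncond:
  fixes l :: "nat \<Rightarrow> real" and d :: nat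
  assumes dec: "decseq l" and lim: "l \<longlonglongrightarrow> 0" and q: "2 \<le> q"
  defines "w \<equiv> \<lambda>j. scaled (of_real (l j)) (unit_vec (j + d)) :: nat \<Rightarrow> 'k::{real_normed_field,banach}"
  shows "w \<in> l2.ell_uncond q"
proof -
  have l0: "0 \<le> l j" for j using dec lim by (rule decseq_ge)
  have w2: "w j \<in> l2" for j unfolding w_def by (intro l2_scaled unit_vec_l2)
  have \<phi>w: "norm (\<phi> (w j)) = l j * norm (\<phi> (unit_vec (j + d)))" if "\<phi> \<in> l2.dual" for \<phi> :: "_ \<Rightarrow> 'k" and j
  proof -
    have "\<phi> (w j) = of_real (l j) * \<phi> (unit_vec (j + d))"
      using that unit_vec_l2 unfolding l2.dual_def w_def
      by (intro l2.linear_functional_scale) auto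
    then show ?thesis using l0[of j] by (simp add: norm_mult)
  qed
  have coeff: "(\<lambda>i. \<phi> (unit_vec i)) \<in> l2" "l2norm (\<lambda>i. \<phi> (unit_vec i)) \<le> l2.dual_norm \<phi>"
    if "\<phi> \<in> l2.dual" for \<phi> :: "_ \<Rightarrow> 'k"
    using l2_functional_coefficients[of \<phi> "l2.dual_norm \<phi>"] l2.dual_norm_bound[OF that] that
    by (auto simp: l2.dual_def)
  have weak: "w \<in> l2.ell_weak q"
    unfolding l2.ell_weak_def mem_Collect_eq
  proof (intro conjI ballI)
    show "range w \<subseteq> l2" using w2 by blast
    fix \<phi> :: "_ \<Rightarrow> 'k" assume \<phi>: "\<phi> \<in> l2.dual"
    have "summable (\<lambda>i. (norm (\<phi> (unit_vec (i + d))))\<^sup>2)"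
      using coeff(1)[OF \<phi>] summable_ignore_initial_segment[of "\<lambda>i. (norm (\<phi> (unit_vec i)))\<^sup>2" d]
      by (simp add: l2_def)
    then have e2: "(\<lambda>i. \<phi> (unit_vec (i + d))) \<in> ell 2"
      by (simp add: ell_def)
    show "(\<lambda>j. \<phi> (w j)) \<in> ell q"
    proof (rule ell_mono[OF e2 zero_less_numeral q])
      show "norm (\<phi> (w j)) \<le> l 0 * norm (\<phi> (unit_vec (j + d)))" for j
        unfolding \<phi>w[OF \<phi>] using decseqD[OF dec, of 0 j] by (intro mult_right_mono) auto
    qed
  qed
  have tail: "(\<Sum>j. norm (\<phi> (w (k + j))) powr q) powr (1 / q) \<le> l k"
    if \<phi>: "\<phi> \<in> l2.dual" and "l2.dual_norm \<phi> \<le> 1" for \<phi> :: "_ \<Rightarrow> 'k" and k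
  proof -
    define c where "c i = \<phi> (unit_vec i)" for i
    have c2: "summable (\<lambda>i. (norm (c i))\<^sup>2)" and c1: "l2norm c \<le> 1"
      using coeff[OF \<phi>] that(2) by (simp_all add: l2_def flip: c_def)
    have total: "(\<Sum>i. (norm (c i))\<^sup>2) \<le> 1"
      using c1 by (simp add: l2norm_def)
    have ci: "norm (c i) \<le> 1" for i
      using norm_le_l2norm[of c i] c2 c1 by (simp add: l2_def)
    have termwise: "norm (\<phi> (w (k + j))) powr q \<le> l k powr q * (norm (c (j + (k + d))))\<^sup>2" for j
    proof -
      have "norm (\<phi> (w (k + j))) \<le> l k * norm (c (j + (k + d)))"
        unfolding \<phi>w[OF \<phi>] c_def using decseqD[OF dec, of k "k + j"]
        by (simp add: ac_simps mult_right_mono)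
      then have "norm (\<phi> (w (k + j))) powr q \<le> (l k * norm (c (j + (k + d)))) powr q"
        using q by (intro powr_mono2) auto
      also have "\<dots> = l k powr q * norm (c (j + (k + d))) powr q"
        using l0 by (simp add: powr_mult)
      also have "\<dots> \<le> l k powr q * norm (c (j + (k + d))) powr 2"
        using ci q by (intro mult_left_mono powr_mono') auto
      finally show ?thesis by simp
    qed
    have partial: "(\<Sum>j<n. norm (\<phi> (w (k + j))) powr q) \<le> l k powr q" for n
    proof -
      have "(\<Sum>j<n. (norm (c (j + (k + d))))\<^sup>2) = (\<Sum>i = 0 + (k + d)..<n + (k + d). (norm (c i))\<^sup>2)"
        by (simp only: sum.shift_bounds_nat_ivl lessThan_atLeast0)
      also have "\<dots> \<le> (\<Sum>i. (norm (c i))\<^sup>2)"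
        by (rule sum_le_suminf[OF c2]) auto
      finally have "(\<Sum>j<n. (norm (c (j + (k + d))))\<^sup>2) \<le> 1" using total by linarith
      then have "l k powr q * (\<Sum>j<n. (norm (c (j + (k + d))))\<^sup>2) \<le> l k powr q * 1"
        by (intro mult_left_mono) auto
      moreover have "(\<Sum>j<n. norm (\<phi> (w (k + j))) powr q)
          \<le> (\<Sum>j<n. l k powr q * (norm (c (j + (k + d))))\<^sup>2)"
        by (intro sum_mono termwise)
      ultimately show ?thesis by (simp add: sum_distrib_left)
    qed
    have sum: "summable (\<lambda>j. norm (\<phi> (w (k + j))) powr q)"
      by (rule summableI_nonneg_bounded[OF _ partial]) simp
    then have "(\<Sum>j. norm (\<phi> (w (k + j))) powr q) \<le> l k powr q"
      by (rule suminf_le_const[OF _ partial])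
    moreover have "0 \<le> (\<Sum>j. norm (\<phi> (w (k + j))) powr q)"
      using sum by (rule suminf_nonneg) simp
    ultimately have "(\<Sum>j. norm (\<phi> (w (k + j))) powr q) powr (1 / q) \<le> (l k powr q) powr (1 / q)"
      using q by (intro powr_mono2) auto
    then show ?thesis using q l0 by (simp add: powr_powr)
  qed
  have zero: "(\<lambda>_. 0 :: 'k) \<in> {\<phi> \<in> l2.dual. l2.dual_norm \<phi> \<le> 1}"
  proof -
    have "(\<lambda>_. 0) \<in> (l2.dual :: ((nat \<Rightarrow> 'k) \<Rightarrow> 'k) set)"
      by (rule l2.bounded_functional_in_dual[where C = 0]) (auto simp: l2.linear_functional_def)
    moreover have "l2.dual_norm (\<lambda>_ :: nat \<Rightarrow> 'k. 0 :: 'k) = 0" by (rule l2.dual_norm_zero)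
    ultimately show ?thesis by simp
  qed
  have upper: "l2.weak_norm q (\<lambda>j. w (k + j)) \<le> l k" for k
    unfolding l2.weak_norm_def by (rule cSUP_least) (use zero tail in auto)
  have lower: "0 \<le> l2.weak_norm q (\<lambda>j. w (k + j))" for k
    unfolding l2.weak_norm_def
  proof (rule cSUP_upper2[OF _ zero])
    show "bdd_above ((\<lambda>\<phi>. (\<Sum>j. norm (\<phi> (w (k + j))) powr q) powr (1 / q)) `
        {\<phi> \<in> l2.dual. l2.dual_norm \<phi> \<le> 1})"
      using tail by (intro bdd_aboveI2[where M = "l k"]) auto
  qed simp
  have "(\<lambda>k. l2.weak_norm q (\<lambda>j. w (k + j))) \<longlonglongrightarrow> 0"
    by (rule tendsto_sandwich[OF _ _ tendsto_const lim]) (use upper lower in auto)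
  then show ?thesis using weak by (simp add: l2.ell_uncond_def)
qed

section \<open>The polynomial\<close>

text \<open>
  The degree is \<open>m + 4\<close>; the exponent \<open>m + 1\<close> is positive, so the polynomial vanishes on both
  hyperplanes \<open>x 0 = 0\<close> and \<open>x 1 = 0\<close>. Off them, its first two factors are nonzero.
\<close>
definition poly_l2 :: "nat \<Rightarrow> (nat \<Rightarrow> 'k) \<Rightarrow> 'k::real_normed_field" where
  "poly_l2 m x = x 0 ^ (m + 1) * x 1 * dot x x"

lemma dot_add_self:
  fixes x h :: "nat \<Rightarrow> 'k::{real_normed_field,banach}"
  assumes "x \<in> l2" "h \<in> l2"
  shows "dot (x + h) (x + h) = dot x x + 2 * dot x h + dot h h"
proof -
  have xh: "x + h \<in> l2" using assms by (rule l2_add)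
  have "dot (x + h) (x + h) = dot (x + h) x + dot (x + h) h"
    using xh assms by (rule dot_add)
  also have "dot (x + h) x = dot x x + dot x h"
    unfolding dot_commute[of "x + h" x] using assms by (intro dot_add)
  also have "dot (x + h) h = dot h x + dot h h"
    unfolding dot_commute[of "x + h" h] using assms by (intro dot_add)
  finally show ?thesis unfolding dot_commute[of h x] by (simp only: mult_2 add.assoc)
qed

lemma tendsto_dot_self:
  fixes a :: "nat \<Rightarrow> 'k::{real_normed_field,banach}"
  assumes a: "a \<in> l2"
  shows "((\<lambda>x. dot x x) \<longlongrightarrow> dot a a) (atin l2.mtopology a)"
proof (rule LIM_zero_cancel)
  let ?F = "atin l2.mtopology a"
  have bound: "\<forall>\<^sub>F x in ?F. norm (dot x x - dot a a)
      \<le> 2 * (l2norm a * l2norm (x - a)) + l2norm (x - a) * l2norm (x - a)"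
    unfolding l2.eventually_atin_metric
  proof (intro exI[of _ 1] conjI allI impI)
    fix x assume "x \<in> l2 \<and> 0 < carrier_dist l2 l2norm x a \<and> carrier_dist l2 l2norm x a < 1"
    then have h: "x - a \<in> l2"
      using l2.subspace_diff[OF l2.carrier_subspace _ a] by blast
    have "a + (x - a) = x" by simp
    with dot_add_self[OF a h] have "dot x x = dot a a + 2 * dot a (x - a) + dot (x - a) (x - a)"
      by (simp only:)
    then have "dot x x - dot a a = 2 * dot a (x - a) + dot (x - a) (x - a)"
      by (simp only: add.assoc add_diff_cancel_left')
    then have "norm (dot x x - dot a a) \<le> norm (2 * dot a (x - a)) + norm (dot (x - a) (x - a))"
      by (simp only: norm_triangle_ineq)
    also have "\<dots> \<le> 2 * (l2norm a * l2norm (x - a)) + l2norm (x - a) * l2norm (x - a)"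
      using norm_dot_le[OF a h] norm_dot_le[OF h h] by (simp add: norm_mult)
    finally show "norm (dot x x - dot a a)
        \<le> 2 * (l2norm a * l2norm (x - a)) + l2norm (x - a) * l2norm (x - a)" .
  qed simp
  have "((\<lambda>x. 2 * (l2norm a * l2norm (x - a)) + l2norm (x - a) * l2norm (x - a)) \<longlongrightarrow>
      2 * (l2norm a * 0) + 0 * 0) ?F"
    by (intro tendsto_add tendsto_mult tendsto_const l2.tendsto_N_diff a)
  then show "((\<lambda>x. dot x x - dot a a) \<longlongrightarrow> 0) ?F"
    by (intro Lim_null_comparison[OF bound]) simp
qed

lemma poly_l2_hom_polynomial:
  "(poly_l2 m :: (nat \<Rightarrow> 'k::{real_normed_field,banach}) \<Rightarrow> 'k) \<in> l2.hom_polynomials (m + 4)"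
  unfolding l2.hom_polynomials_def mem_Collect_eq
proof
  have "(poly_l2 m \<longlongrightarrow> poly_l2 m a) (atin l2.mtopology a)" if a: "a \<in> l2" for a :: "nat \<Rightarrow> 'k"
  proof -
    have coord: "((\<lambda>x. x k) \<longlongrightarrow> a k) (atin l2.mtopology a)" for k
    proof -
      have "continuous_map l2.mtopology euclidean (dot (unit_vec k :: nat \<Rightarrow> 'k))"
        using dot_in_dual[OF unit_vec_l2, of k] unfolding l2.dual_def by blast
      then have "(dot (unit_vec k) \<longlongrightarrow> dot (unit_vec k) a) (atin l2.mtopology a)"
        using a by (simp only: l2.continuous_map_iff_tendsto)
      moreover have "dot (unit_vec k) = (\<lambda>x :: nat \<Rightarrow> 'k. x k)" by (simp add: fun_eq_iff dot_unit_vec)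
      ultimately show ?thesis by (simp only:)
    qed
    show ?thesis
      unfolding poly_l2_def by (intro tendsto_mult tendsto_power coord tendsto_dot_self a)
  qed
  then show "continuous_map l2.mtopology euclidean (poly_l2 m :: (nat \<Rightarrow> 'k) \<Rightarrow> 'k)"
    unfolding l2.continuous_map_iff_tendsto by (rule ballI)
  \<comment> \<open>slots \<open>0, \<dots>, m\<close> feed coordinate \<open>0\<close>, slot \<open>m + 1\<close> coordinate \<open>1\<close>, the last two \<open>dot\<close>\<close>
  define A :: "(nat \<Rightarrow> nat \<Rightarrow> 'k) \<Rightarrow> 'k"
    where "A t = (\<Prod>i\<le>m. t i 0) * t (m + 1) 1 * dot (t (m + 2)) (t (m + 3))" for t
  have "l2.multilinear_form (m + 4) A"
    unfolding l2.multilinear_form_def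
  proof (intro ballI allI impI)
    fix t :: "nat \<Rightarrow> nat \<Rightarrow> 'k" and i
    assume t: "t \<in> {..<m + 4} \<rightarrow>\<^sub>E l2" and i: "i < m + 4"
    have t2: "t (m + 2) \<in> l2" "t (m + 3) \<in> l2" using PiE_mem[OF t, of "m + 2"] PiE_mem[OF t, of "m + 3"] by simp_all
    have far: "(\<Prod>k\<le>m. (t(i := u)) k 0) = (\<Prod>k\<le>m. t k 0)" if "m < i" for u
      using that by (intro prod.cong) auto
    consider "i \<le> m" | "i = m + 1" | "i = m + 2" | "i = m + 3" using i by linarith
    then show "(\<forall>u\<in>l2. \<forall>v\<in>l2. A (t(i := u + v)) = A (t(i := u)) + A (t(i := v))) \<and>
        (\<forall>c. \<forall>u\<in>l2. A (t(i := scaled c u)) = c * A (t(i := u)))"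
    proof cases
      case 1
      have "(\<Prod>k\<le>m. (t(i := u)) k 0) = u 0 * (\<Prod>k\<in>{..m} - {i}. t k 0)" for u
        using 1 by (subst prod.remove[of _ i]) (auto intro!: prod.cong)
      then have "A (t(i := u)) = u 0 * ((\<Prod>k\<in>{..m} - {i}. t k 0) * t (m + 1) 1 * dot (t (m + 2)) (t (m + 3)))" for u
        using 1 by (simp add: A_def)
      then show ?thesis by (simp add: scaled_def distrib_right mult.assoc)
    next
      case 2
      have "A (t(i := u)) = u 1 * ((\<Prod>k\<le>m. t k 0) * dot (t (m + 2)) (t (m + 3)))" for u
        using 2 far by (simp add: A_def)
      then show ?thesis by (simp add: scaled_def distrib_right mult.assoc)
    next
      case 3
      have "A (t(i := u)) = dot (t (m + 3)) u * ((\<Prod>k\<le>m. t k 0) * t (m + 1) 1)" for u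
        using 3 far by (simp add: A_def dot_commute[of u])
      then show ?thesis using t2 by (auto simp only: dot_add dot_scaled distrib_right mult.assoc)
    next
      case 4
      have "A (t(i := u)) = dot (t (m + 2)) u * ((\<Prod>k\<le>m. t k 0) * t (m + 1) 1)" for u
        using 4 far by (simp add: A_def)
      then show ?thesis using t2 by (auto simp only: dot_add dot_scaled distrib_right mult.assoc)
    qed
  qed
  moreover have "\<forall>x\<in>l2. poly_l2 m x = A (\<lambda>i\<in>{..<m + 4}. x)"
  proof
    fix x :: "nat \<Rightarrow> 'k"
    have "(\<Prod>i\<le>m. (\<lambda>i\<in>{..<m + 4}. x) i 0) = (\<Prod>i\<le>m. x 0)"
      by (intro prod.cong) auto
    then show "poly_l2 m x = A (\<lambda>i\<in>{..<m + 4}. x)" by (simp add: poly_l2_def A_def)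
  qed
  ultimately have A: "l2.multilinear_form (m + 4) A \<and> (\<forall>x\<in>l2. poly_l2 m x = A (\<lambda>i\<in>{..<m + 4}. x))"
    by (rule conjI)
  show "\<exists>A. l2.multilinear_form (m + 4) A \<and>
      (\<forall>x\<in>(l2 :: (nat \<Rightarrow> 'k) set). poly_l2 m x = A (\<lambda>i\<in>{..<m + 4}. x))"
    by (rule exI[where x = A], rule A)
qed

text \<open>
  On bounded sets the polynomial is dominated by each of the two coordinates. This linear
  domination transfers the weak \<open>q\<close>-summability of a sequence to the values of the polynomial.
\<close>
lemma norm_poly_l2_le:
  fixes x :: "nat \<Rightarrow> 'k::{real_normed_field,banach}"
  assumes x: "x \<in> l2" "l2norm x \<le> R" and i: "i = 0 \<or> i = 1"
  shows "norm (poly_l2 m x) \<le> R ^ (m + 3) * norm (x i)"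
proof -
  have R: "0 \<le> R" using l2norm_nonneg[OF x(1)] x(2) by linarith
  have coord: "norm (x k) \<le> R" for k using norm_le_l2norm[OF x(1), of k] x(2) by linarith
  have "norm (dot x x) \<le> l2norm x * l2norm x" using x(1) x(1) by (rule norm_dot_le)
  also have "\<dots> \<le> R * R" using x l2norm_nonneg[OF x(1)] by (intro mult_mono) auto
  finally have dot: "norm (dot x x) \<le> R * R" .
  have "norm (x 0) ^ (m + 1) * norm (x 1) \<le> R ^ (m + 1) * norm (x i)"
  proof (cases "i = 1")
    case True
    then show ?thesis by (simp add: mult_right_mono power_mono coord del: power_Suc)
  next
    case False
    then have "norm (x 0) ^ (m + 1) * norm (x 1) = norm (x 0) ^ m * norm (x 1) * norm (x i)"
      using i by simp
    also have "\<dots> \<le> R ^ m * R * norm (x i)"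
      using R by (intro mult_right_mono mult_mono power_mono coord) auto
    finally show ?thesis by (simp add: mult_ac)
  qed
  then have "norm (x 0) ^ (m + 1) * norm (x 1) * norm (dot x x) \<le> R ^ (m + 1) * norm (x i) * (R * R)"
    by (rule mult_mono[OF _ dot]) (use R in auto)
  also have "\<dots> = R ^ (m + 3) * norm (x i)" by (simp add: power_add power3_eq_cube)
  finally show ?thesis by (simp add: poly_l2_def norm_mult norm_power)
qed

lemma poly_l2_summing_at:
  fixes a :: "nat \<Rightarrow> 'k::{real_normed_field,banach}"
  assumes a: "a \<in> l2" "a i = 0" and i: "i = 0 \<or> i = 1" and pq: "0 < q" "q \<le> p"
  shows "a \<in> l2.summing_set p q (poly_l2 m)"
  unfolding l2.summing_set_def l2.summing_at_def mem_Collect_eq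
proof (intro conjI ballI a(1))
  fix x :: "nat \<Rightarrow> nat \<Rightarrow> 'k" assume x: "x \<in> l2.ell_uncond q"
  then have weak: "x \<in> l2.ell_weak q" by (simp add: l2.ell_uncond_def)
  then have x2: "x j \<in> l2" for j unfolding l2.ell_weak_def by auto
  obtain R where R: "\<And>j. l2norm (x j) \<le> R" using ell_uncond_bounded[OF x pq(1)] by metis
  have "(\<lambda>j. dot (unit_vec i) (x j)) \<in> ell q"
    using weak dot_in_dual[OF unit_vec_l2] unfolding l2.ell_weak_def by blast
  then have coord: "(\<lambda>j. x j i) \<in> ell q" by (simp add: dot_unit_vec)
  have "norm (poly_l2 m (a + x j) - poly_l2 m a) \<le> (l2norm a + R) ^ (m + 3) * norm (x j i)" for j
  proof -
    have "poly_l2 m a = 0" using a(2) i by (auto simp: poly_l2_def)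
    moreover have "norm (poly_l2 m (a + x j)) \<le> (l2norm a + R) ^ (m + 3) * norm ((a + x j) i)"
      using l2_add(1)[OF a(1) x2] order_trans[OF l2_add(2)[OF a(1) x2] add_left_mono[OF R]] i
      by (rule norm_poly_l2_le)
    ultimately show ?thesis using a(2) by simp
  qed
  then show "(\<lambda>j. poly_l2 m (a + x j) - poly_l2 m a) \<in> ell p"
    by (rule ell_mono[OF coord pq])
qed

text \<open>
  Near \<open>unit_vec 0 + unit_vec 1\<close>, changing only coordinates from \<open>2\<close> on, the polynomial is
  \<open>dot x x\<close>. Along the multiples \<open>l j\<close> of the unit vectors it grows by \<open>(l j)\<^sup>2\<close>, which tends
  to \<open>0\<close> as slowly as desired.
\<close>
lemma poly_l2_not_summing_at:
  assumes q: "2 \<le> q" and p: "0 < p"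
  shows "unit_vec 0 + unit_vec 1
    \<notin> l2.summing_set p q (poly_l2 m :: (nat \<Rightarrow> 'k::{real_normed_field,banach}) \<Rightarrow> 'k)"
proof
  define a :: "nat \<Rightarrow> 'k" where "a = unit_vec 0 + unit_vec 1"
  \<comment> \<open>chosen such that \<open>((l j)\<^sup>2) powr p\<close> is the harmonic sequence\<close>
  define l where "l j = (1 / real (Suc j)) powr (1 / (2 * p))" for j
  define w :: "nat \<Rightarrow> nat \<Rightarrow> 'k" where "w j = scaled (of_real (l j)) (unit_vec (j + 2))" for j
  have a2: "a \<in> l2" unfolding a_def by (intro l2_add unit_vec_l2)
  assume "unit_vec 0 + unit_vec 1 \<in> l2.summing_set p q (poly_l2 m :: (nat \<Rightarrow> 'k) \<Rightarrow> 'k)"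
  then have summing: "l2.summing_at p q (poly_l2 m) a"
    by (simp add: l2.summing_set_def a_def)
  have "decseq l" unfolding decseq_def l_def
    using p by (auto intro!: powr_mono2 divide_left_mono)
  moreover have "l \<longlonglongrightarrow> 0"
  proof -
    have "(\<lambda>j. 1 / real (Suc j)) \<longlonglongrightarrow> 0" using LIMSEQ_inverse_real_of_nat by (simp add: divide_inverse)
    then show ?thesis unfolding l_def
      using p by (intro tendsto_eq_rhs[OF tendsto_powr2[OF _ tendsto_const]]) auto
  qed
  ultimately have w: "w \<in> l2.ell_uncond q"
    unfolding w_def using q by (rule null_multiples_of_unit_vecs_in_ell_uncond)
  have "norm (poly_l2 m (a + w j) - poly_l2 m a) powr p = 1 / real (Suc j)" for j
  proof -
    have w2: "w j \<in> l2" unfolding w_def by (intro l2_scaled unit_vec_l2)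
    have wdot: "dot x (w j) = of_real (l j) * x (j + 2)" if "x \<in> l2" for x
    proof -
      have "dot x (w j) = of_real (l j) * dot x (unit_vec (j + 2))"
        unfolding w_def using that unit_vec_l2 by (rule dot_scaled)
      then show ?thesis unfolding dot_commute[of x "unit_vec (j + 2)"] dot_unit_vec .
    qed
    have aw: "dot a (w j) = 0"
      unfolding wdot[OF a2] by (simp add: a_def unit_vec_def)
    have ww: "dot (w j) (w j) = of_real ((l j)\<^sup>2)"
      unfolding wdot[OF w2] by (simp add: w_def scaled_def unit_vec_def power2_eq_square)
    have coord: "a 0 = 1" "a 1 = 1" "(a + w j) 0 = 1" "(a + w j) 1 = 1"
      by (simp_all add: a_def w_def scaled_def unit_vec_def)
    have "poly_l2 m (a + w j) - poly_l2 m a = of_real ((l j)\<^sup>2)"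
      unfolding poly_l2_def dot_add_self[OF a2 w2] aw ww coord by simp
    then have "norm (poly_l2 m (a + w j) - poly_l2 m a) = l j powr 2"
      by (simp add: norm_power l_def)
    then show ?thesis using p by (simp add: l_def powr_powr)
  qed
  moreover have "(\<lambda>j. poly_l2 m (a + w j) - poly_l2 m a) \<in> ell p"
    using summing w unfolding l2.summing_at_def by blast
  ultimately have "summable (\<lambda>j. 1 / real (Suc j))" by (simp add: ell_def)
  then show False
    using not_summable_harmonic[where 'a=real] summable_Suc_iff[of "\<lambda>n. inverse (real n)"]
    by (simp add: inverse_eq_divide)
qed

lemma ex_summing_set_not_subspace:
  fixes n :: nat and p q :: real
  assumes n: "4 \<le> n" and q: "2 \<le> q" and p: "q \<le> p"
  shows
    "\<exists>(scale :: 'k::{real_normed_field,banach} \<Rightarrow> (nat \<Rightarrow> 'k) \<Rightarrow> (nat \<Rightarrow> 'k)) E N.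
        banach_space_on scale E N \<and>
        (\<exists>P \<in> normed_space_on.hom_polynomials scale E N n.
           banach_space_on.summing_set scale E N p q P \<noteq> {} \<and>
           \<not> module.subspace scale (banach_space_on.summing_set scale E N p q P))"
proof (intro exI conjI bexI)
  obtain m where m: "n = m + 4" using n le_Suc_ex[of 4 n] by (auto simp: add.commute)
  let ?P = "poly_l2 (n - 4) :: (nat \<Rightarrow> 'k) \<Rightarrow> 'k"
  let ?S = "l2.summing_set p q ?P"
  show "banach_space_on scaled (l2 :: (nat \<Rightarrow> 'k) set) l2norm" by (rule l2_banach_space)
  show "?P \<in> l2.hom_polynomials n" using poly_l2_hom_polynomial[of m] by (simp add: m)
  have e0: "unit_vec 0 \<in> ?S"
    by (rule poly_l2_summing_at[OF unit_vec_l2, where i = 1]) (use q p in \<open>auto simp: unit_vec_def\<close>)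
  have e1: "unit_vec 1 \<in> ?S"
    by (rule poly_l2_summing_at[OF unit_vec_l2, where i = 0]) (use q p in \<open>auto simp: unit_vec_def\<close>)
  from e0 show "?S \<noteq> {}" by blast
  show "\<not> l2.subspace ?S"
  proof
    assume "l2.subspace ?S"
    then have "unit_vec 0 + unit_vec 1 \<in> ?S" using e0 e1 by (rule l2.subspace_add)
    moreover have "unit_vec 0 + unit_vec 1 \<notin> ?S"
      by (rule poly_l2_not_summing_at) (use q p in auto)
    ultimately show False by contradiction
  qed
qed

theorem proposition4p9:
  fixes n :: nat and p q :: real
  assumes "4 \<le> n" and "2 \<le> q" and "q \<le> p"
  shows
    "(\<exists>(scale :: real \<Rightarrow> (nat \<Rightarrow> real) \<Rightarrow> (nat \<Rightarrow> real)) E N.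
        banach_space_on scale E N \<and>
        (\<exists>P \<in> normed_space_on.hom_polynomials scale E N n.
           banach_space_on.summing_set scale E N p q P \<noteq> {} \<and>
           \<not> module.subspace scale (banach_space_on.summing_set scale E N p q P))) \<and>
     (\<exists>(scale :: complex \<Rightarrow> (nat \<Rightarrow> complex) \<Rightarrow> (nat \<Rightarrow> complex)) E N.
        banach_space_on scale E N \<and>
        (\<exists>P \<in> normed_space_on.hom_polynomials scale E N n.
           banach_space_on.summing_set scale E N p q P \<noteq> {} \<and>
           \<not> module.subspace scale (banach_space_on.summing_set scale E N p q P)))"
  using ex_summing_set_not_subspace[OF assms, where 'k=real]
    ex_summing_set_not_subspace[OF assms, where 'k=complex] by (rule conjI)

end
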